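(* Let $I_2>I_1>I_3$. The scaled period $\hat P_3$ of the twisting motion with rotor off and the change of somersault angle $\Phi_3$ during such a period are given by \[ \gamma\hat P_3=\frac{8}{(s_++s_-)\sqrt{1-\nu}}K(k^2),\qquad k=\frac{s_+-s_-}{s_++s_-},\qquad \nu=\frac{\delta}{\gamma}, \] and \[ \Phi_3-\hat P_3=\frac{8}{(s_++s_-)\sqrt{1-\nu}}\left(\Pi(n_-,k^2)-\Pi(n_+,k^2)\right),\qquad n_\pm=k\,\frac{1\pm s_-}{1\mp s_-}. \]
   Context: A rigid body has principal moments of inertia $I_1,I_2,I_3$ and constant total angular momentum of magnitude $l$; an attached rotor is off. Put $\delta=I_1/I_2-1$ and $\gamma=I_1/I_3-1$. With somersault angle $\phi$, tilt angle $\theta$ and twist angle $\psi$, the equations of motion in dimensionless time $\tau=tl/I_1$ (prime denotes $d/d\tau$) are $\phi'=1+\delta\sin^2\psi$, $\theta'=-\delta\cos\theta\cos\psi\sin\psi$, $\psi'=\gamma\sin\theta-\delta\sin\theta\sin^2\psi$, with conserved dimensionless energy $E=\frac12(1+\gamma\sin^2\theta+\delta\cos^2\theta\sin^2\psi)$. In the twisting motion $\psi$ advances by $2\pi$ per period, and $\hat P_3=lP_3/I_1$ is the dimensionless period. The quantities $s_-=\sin\theta_{min}$ and $s_+=\sin\theta_{max}$ are determined by the extremal values of $\theta$ during the twisting motion; equating the energy at $\psi=0$ (where $\theta=\theta_{min}$) and $\psi=\pi/2$ (where $\theta=\theta_{max}$) gives $s_+^2+(1-s_+^2)\nu=s_-^2$.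 The complete elliptic integrals of the first and third kind are $K(k^2)=\int_0^{\pi/2}\frac{d\alpha}{\sqrt{1-k^2\sin^2\alpha}}$ and $\Pi(n,k^2)=\int_0^{\pi/2}\frac{d\alpha}{(1-n\sin^2\alpha)\sqrt{1-k^2\sin^2\alpha}}$.
   Formalization: The printed formula for Φ_3 − P̂_3 is false: its prefactor lacks a factor s_-; the formal version proves it with 8s_-/((s_+ + s_-)√(1−ν)) instead of 8/((s_+ + s_-)√(1−ν)). *)

theory Defs
  imports "HOL-Analysis.Analysis"
begin

text \<open>Complete elliptic integrals; the last argument is the parameter \<open>m = k\<^sup>2\<close>, not the modulus \<open>k\<close>.\<close>

definition ellipticK :: "real \<Rightarrow> real" where
  "ellipticK m = integral {0..pi/2} (\<lambda>\<alpha>. 1 / sqrt (1 - m * (sin \<alpha>)\<^sup>2))"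

definition ellipticPi :: "real \<Rightarrow> real \<Rightarrow> real" where
  "ellipticPi n m =
     integral {0..pi/2} (\<lambda>\<alpha>. 1 / ((1 - n * (sin \<alpha>)\<^sup>2) * sqrt (1 - m * (sin \<alpha>)\<^sup>2)))"

text \<open>
  Rotor-off motion in dimensionless time, with somersault angle \<open>\<phi>\<close>, tilt angle \<open>\<theta>\<close> and twist
  angle \<open>\<psi>\<close>. All angles are real-valued lifts, so that \<open>\<phi>\<close> and \<open>\<psi>\<close> may grow without bound. The tilt
  is confined to the open chart \<open>\<bar>\<theta>\<bar> < \<pi>/2\<close>: at \<open>\<bar>\<theta>\<bar> = \<pi>/2\<close> the angle coordinates are singular.
\<close>

definition rotor_off_motion ::
  "real \<Rightarrow> real \<Rightarrow> (real \<Rightarrow> real) \<Rightarrow> (real \<Rightarrow> real) \<Rightarrow> (real \<Rightarrow> real) \<Rightarrow> bool" where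
  "rotor_off_motion \<delta> \<gamma> \<phi> \<theta> \<psi> \<longleftrightarrow>
     (\<forall>\<tau>. (\<phi> has_real_derivative 1 + \<delta> * (sin (\<psi> \<tau>))\<^sup>2) (at \<tau>)) \<and>
     (\<forall>\<tau>. (\<theta> has_real_derivative - \<delta> * cos (\<theta> \<tau>) * cos (\<psi> \<tau>) * sin (\<psi> \<tau>)) (at \<tau>)) \<and>
     (\<forall>\<tau>. (\<psi> has_real_derivative \<gamma> * sin (\<theta> \<tau>) - \<delta> * sin (\<theta> \<tau>) * (sin (\<psi> \<tau>))\<^sup>2) (at \<tau>)) \<and>
     (\<forall>\<tau>. - (pi/2) < \<theta> \<tau> \<and> \<theta> \<tau> < pi/2)"

text \<open>
  The twist angle makes at least one full positive turn, as opposed to oscillating about a fixed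
  value, standing still, or turning backwards. Periodicity is not assumed here.
\<close>

definition twisting :: "(real \<Rightarrow> real) \<Rightarrow> bool" where
  "twisting \<psi> \<longleftrightarrow> (\<exists>\<tau>1 \<tau>2. \<tau>1 < \<tau>2 \<and> \<psi> \<tau>2 = \<psi> \<tau>1 + 2 * pi)"

text \<open>
  \<open>P\<close> is a period in the dimensional time \<open>t\<close>, where \<open>\<tau> = t l / I1\<close>. The tilt alone already repeats
  after a half turn of \<open>\<psi>\<close>; a period of the twisting motion is a full turn.
\<close>

definition twist_period ::
  "real \<Rightarrow> real \<Rightarrow> (real \<Rightarrow> real) \<Rightarrow> (real \<Rightarrow> real) \<Rightarrow> real \<Rightarrow> bool" where
  "twist_period I1 l \<theta> \<psi> P \<longleftrightarrow> 0 < P \<and>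
     (\<forall>t. \<theta> ((t + P) * l / I1) = \<theta> (t * l / I1) \<and>
          \<psi> ((t + P) * l / I1) = \<psi> (t * l / I1) + 2 * pi)"

definition theta_min :: "(real \<Rightarrow> real) \<Rightarrow> real" where
  "theta_min \<theta> = (INF \<tau>. \<theta> \<tau>)"

definition theta_max :: "(real \<Rightarrow> real) \<Rightarrow> real" where
  "theta_max \<theta> = (SUP \<tau>. \<theta> \<tau>)"

text \<open>
  Over one period, the change of \<open>\<phi>\<close> minus the scaled period is the integral of \<open>\<delta> sin\<^sup>2 \<psi>\<close>.
  Its closed form is
  \<open>8 s\<^sub>- / ((s\<^sub>+ + s\<^sub>-) sqrt (1 - \<nu>)) (\<Pi>(n\<^sub>-, k\<^sup>2) - \<Pi>(n\<^sub>+, k\<^sup>2))\<close>.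
  The factor \<open>s\<^sub>-\<close> in the numerator is absent from the published formula but necessary: as \<open>\<nu>\<close> tends
  to 0 with \<open>s\<^sub>- = s\<close> fixed, the integral is \<open>\<pi>\<nu>/s\<close> to leading order, whereas the expression without
  the factor is \<open>\<pi>\<nu>/s\<^sup>2\<close>.
\<close>

end

theory Submission
  imports Defs
begin

text \<open>
  Write \<open>S = sin\<^sup>2 \<psi>\<close> and \<open>x = sin \<theta>\<close>. Conservation of energy reads
  \<open>x\<^sup>2 (1 - \<nu> S) = a\<^sup>2 - \<nu> S\<close>, where \<open>a\<^sup>2\<close> is the value of \<open>x\<^sup>2\<close> at a time with \<open>sin \<psi> = 0\<close>;
  a full turn of \<open>\<psi>\<close> contains such a time. The case \<open>a = 0\<close> is the separatrix: \<open>\<psi>'\<close> would be bounded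
  by a multiple of the distance of \<open>\<psi>\<close> to a rest point that it attains, so \<open>\<psi>\<close> would be constant.
  Hence \<open>a > 0\<close>, and since \<open>\<nu> < 0\<close> the tilt never vanishes; it is positive because \<open>\<psi>\<close>
  turns forwards. Since \<open>x\<^sup>2\<close> increases with \<open>S\<close>, the extremal tilts occur at \<open>S = 0\<close> and \<open>S = 1\<close>, so
  \<open>a = s\<^sub>-\<close> and \<open>b = s\<^sub>+\<close> satisfies \<open>b\<^sup>2 + (1 - b\<^sup>2) \<nu> = a\<^sup>2\<close>.

  Eliminating \<open>\<theta>\<close> gives the autonomous equation \<open>\<psi>' = \<gamma> R(S)\<close> with
  \<open>R(S) = sqrt ((1 - \<nu> S) (a\<^sup>2 - \<nu> S)) > 0\<close>. Let \<open>F\<close> be an antiderivative of \<open>1 / R(sin\<^sup>2 y)\<close>.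
  Then \<open>F (\<psi> \<tau>) - \<gamma> \<tau>\<close> is constant. As \<open>F\<close> is injective and grows by the same amount over every
  interval of length \<open>2 \<pi>\<close>, the motion is periodic, and \<open>\<gamma>\<close> times the period is four times the
  integral of \<open>1 / R\<close> over a quarter turn. Likewise the excess of \<open>\<phi>\<close> over time is four times
  the quarter-turn integral of \<open>\<nu> S / R\<close>. This is \<open>twist_quadrature\<close>.

  Both integrals are brought to normal form by Landen's transformation, which in terms of the tilt is
  \<open>x = a (1 + k Z) / (1 - k Z)\<close> with \<open>Z = sin\<^sup>2 \<alpha>\<close>: it maps \<open>0 \<le> Z \<le> 1\<close> onto \<open>a \<le> x \<le> b\<close> and turns
  \<open>d\<psi> / R\<close> into a constant multiple of \<open>d\<alpha> / sqrt (1 - k\<^sup>2 Z)\<close>. The first integral then is a multiple of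
  \<open>K\<close>. In the second, \<open>\<nu> S = (x\<^sup>2 - a\<^sup>2) / (x\<^sup>2 - 1)\<close> has simple poles at \<open>x = 1\<close> and \<open>x = -1\<close>, which
  correspond to \<open>Z = 1 / n\<^sub>+\<close> and \<open>Z = 1 / n\<^sub>-\<close>. The constant terms of the partial fractions cancel, so
  only the difference of the two integrals of the third kind remains (\<open>landen_substitution\<close>,
  \<open>partial_fractions\<close>).
\<close>

section \<open>The rate of the twist\<close>

text \<open>
  The twist angle satisfies \<open>\<psi>' = \<gamma> \<cdot> twist_rate a \<nu> (sin\<^sup>2 \<psi>)\<close> once the tilt is eliminated by the energy
  integral, \<open>a\<close> being the sine of the minimal tilt.
\<close>

definition twist_rate :: "real \<Rightarrow> real \<Rightarrow> real \<Rightarrow> real" where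
  "twist_rate a \<nu> S = sqrt ((1 - \<nu> * S) * (a\<^sup>2 - \<nu> * S))"

lemma twist_rate_pos:
  assumes "0 < a" "\<nu> \<le> 0" "0 \<le> S"
  shows "0 < twist_rate a \<nu> S"
proof -
  have "\<nu> * S \<le> 0" using assms by (simp add: mult_nonpos_nonneg)
  then show ?thesis
    unfolding twist_rate_def using assms
    by (simp add: less_le_trans[of _ 0] le_less_trans[of "\<nu> * S" 0])
qed

section \<open>Landen's transformation of the quarter-turn integrals\<close>

lemma factor_pos:
  assumes "0 \<le> n" "n < 1" "0 \<le> Z" "Z \<le> (1::real)"
  shows "0 < 1 - n * Z"
  using mult_left_le[of Z n] assms by linarith

text \<open>
  The numbers \<open>a\<close> and \<open>b\<close> stand for \<open>s\<^sub>-\<close> and \<open>s\<^sub>+\<close>, the extremal values of \<open>sin \<theta>\<close>.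
\<close>

locale landen_parameters =
  fixes a b \<nu> k n_plus n_minus :: real
  assumes a_pos: "0 < a" and a_less_b: "a < b" and b_less_1: "b < 1"
    and energy_relation: "b\<^sup>2 + (1 - b\<^sup>2) * \<nu> = a\<^sup>2"
    and k_def: "k = (b - a) / (b + a)"
    and n_plus_def: "n_plus = k * ((1 + a) / (1 - a))"
    and n_minus_def: "n_minus = k * ((1 - a) / (1 + a))"
begin

text \<open>
  \<open>D\<close> is the denominator of the rational function \<open>Z \<mapsto> M Z / D Z\<close> that expresses \<open>sin\<^sup>2 \<psi>\<close> by
  \<open>Z = sin\<^sup>2 \<alpha>\<close>; solving \<open>x\<^sup>2 (1 - \<nu> S) = a\<^sup>2 - \<nu> S\<close> for \<open>S\<close> with \<open>x = a (1 + k Z) / (1 - k Z)\<close> gives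
  this function.
\<close>

definition D :: "real \<Rightarrow> real" where
  "D Z = (1 - n_plus * Z) * (1 - n_minus * Z)"

text \<open>With this normalisation \<open>\<alpha> = \<pi>/2\<close> corresponds to \<open>\<psi> = \<pi>/2\<close>.\<close>

definition M :: real where
  "M = D 1"

definition landen_sine :: "real \<Rightarrow> real" where
  "landen_sine \<alpha> = sqrt M * sin \<alpha> / sqrt (D ((sin \<alpha>)\<^sup>2))"

text \<open>The twist angle \<open>\<psi>\<close> as a function of Landen's angle \<open>\<alpha>\<close>, on the quarter turn \<open>[0, \<pi>/2]\<close>.\<close>

definition landen_angle :: "real \<Rightarrow> real" where
  "landen_angle \<alpha> = arcsin (landen_sine \<alpha>)"

lemma a_less_1: "a < 1"
  using a_less_b b_less_1 by simp

lemma squares_less: "a\<^sup>2 < b\<^sup>2" "a\<^sup>2 < 1" "b\<^sup>2 < 1"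
  using a_pos a_less_b b_less_1
  by (auto intro: power_strict_mono simp: abs_square_less_1)

lemma nu_eq: "\<nu> = (a\<^sup>2 - b\<^sup>2) / (1 - b\<^sup>2)"
  using energy_relation squares_less by (simp add: field_simps)

lemma nu_neg: "\<nu> < 0"
  unfolding nu_eq using squares_less by (simp add: divide_less_0_iff)

lemma one_minus_nu: "1 - \<nu> = (1 - a\<^sup>2) / (1 - b\<^sup>2)"
  unfolding nu_eq using squares_less by (simp add: field_simps)

lemma k_bounds: "0 < k" "k < 1"
  unfolding k_def using a_pos a_less_b by (auto simp: field_simps)

lemma n_product: "n_plus * n_minus = k\<^sup>2"
  unfolding n_plus_def n_minus_def using a_pos a_less_1 by (simp add: power2_eq_square)

lemma one_minus_n_plus: "1 - n_plus = 2 * a * (1 - b) / ((1 - a) * (a + b))"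
proof -
  have "a + b \<noteq> 0" "1 - a \<noteq> 0" using a_pos a_less_b a_less_1 by auto
  then show ?thesis unfolding n_plus_def k_def by (simp add: divide_simps) (simp add: algebra_simps)
qed

lemma one_minus_n_minus: "1 - n_minus = 2 * a * (1 + b) / ((1 + a) * (a + b))"
proof -
  have "a + b \<noteq> 0" "1 + a \<noteq> 0" using a_pos a_less_b a_less_1 by auto
  then show ?thesis unfolding n_minus_def k_def by (simp add: divide_simps) (simp add: algebra_simps)
qed

lemma n_bounds: "0 < n_plus" "n_plus < 1" "0 < n_minus" "n_minus < 1"
proof -
  show "0 < n_plus" "0 < n_minus"
    unfolding n_plus_def n_minus_def using k_bounds a_pos a_less_1 by simp_all
  have "0 < 1 - n_plus" "0 < 1 - n_minus"
    unfolding one_minus_n_plus one_minus_n_minus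
    using a_pos a_less_b b_less_1 a_less_1 by simp_all
  then show "n_plus < 1" "n_minus < 1" by simp_all
qed

lemma M_eq: "M = (2 * a / ((a + b) * sqrt (1 - \<nu>)))\<^sup>2"
proof -
  have nz: "a + b \<noteq> 0" "1 + a \<noteq> 0" "1 - a \<noteq> 0" "1 - a\<^sup>2 \<noteq> 0" "1 - b\<^sup>2 \<noteq> 0"
    using a_pos a_less_b a_less_1 squares_less by auto
  have "M = 4 * a\<^sup>2 * ((1 - b) * (1 + b)) / (((1 - a) * (1 + a)) * (a + b)\<^sup>2)"
    unfolding M_def D_def mult_1_right one_minus_n_plus one_minus_n_minus
      times_divide_times_eq power2_eq_square
    by (rule arg_cong2[where f = "(/)"]) algebra+
  also have "\<dots> = 4 * a\<^sup>2 * (1 - b\<^sup>2) / ((1 - a\<^sup>2) * (a + b)\<^sup>2)"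
    by (simp add: power2_eq_square algebra_simps)
  also have "\<dots> = 4 * a\<^sup>2 / ((a + b)\<^sup>2 * (1 - \<nu>))"
    unfolding one_minus_nu using nz by simp
  finally show ?thesis
    using nu_neg by (simp add: power_divide power_mult_distrib)
qed

lemma sqrt_M: "sqrt M = 2 * a / ((a + b) * sqrt (1 - \<nu>))"
  unfolding M_eq using a_pos a_less_b nu_neg by simp

lemma M_pos: "0 < M"
  unfolding M_eq using a_pos a_less_b nu_neg by simp

lemma D_pos: "0 \<le> Z \<Longrightarrow> Z \<le> 1 \<Longrightarrow> 0 < D Z"
  unfolding D_def using n_bounds by (intro mult_pos_pos factor_pos) auto

lemma k2_bounds: "0 < k\<^sup>2" "k\<^sup>2 < 1"
  using k_bounds by (auto simp: power_less_one_iff abs_square_less_1)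

lemma D_poly: "D Z = 1 - (n_plus + n_minus) * Z + k\<^sup>2 * Z\<^sup>2"
  unfolding D_def n_product[symmetric] by (simp add: algebra_simps power2_eq_square)

lemma nu_M: "\<nu> * M = - 4 * k * a\<^sup>2 / (1 - a\<^sup>2)"
proof -
  have nz: "a + b \<noteq> 0" "1 - a\<^sup>2 \<noteq> 0" "1 - b\<^sup>2 \<noteq> 0"
    using a_pos a_less_b squares_less by auto
  have "\<nu> * M = (a\<^sup>2 - b\<^sup>2) / (1 - b\<^sup>2) * (4 * a\<^sup>2 / ((a + b)\<^sup>2 * ((1 - a\<^sup>2) / (1 - b\<^sup>2))))"
    unfolding M_eq one_minus_nu[symmetric] nu_eq[symmetric] using nu_neg
    by (simp add: power_divide power_mult_distrib)
  also have "\<dots> = (a\<^sup>2 - b\<^sup>2) * (4 * a\<^sup>2) / ((a + b)\<^sup>2 * (1 - a\<^sup>2))"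
    using nz by simp
  also have "\<dots> = - 4 * ((b - a) * (b + a)) * a\<^sup>2 / ((a + b) * (a + b) * (1 - a\<^sup>2))"
    by (simp add: power2_eq_square algebra_simps)
  also have "\<dots> = - 4 * k * a\<^sup>2 / (1 - a\<^sup>2)"
    unfolding k_def using nz by (simp add: divide_simps) (simp add: algebra_simps)
  finally show ?thesis .
qed

lemma n_sum: "n_plus + n_minus = 2 * k * (1 + a\<^sup>2) / (1 - a\<^sup>2)"
  and n_diff: "n_minus - n_plus = - 4 * k * a / (1 - a\<^sup>2)"
proof -
  have nz: "1 + a \<noteq> 0" "1 - a \<noteq> 0" using a_pos a_less_1 by auto
  have f: "1 - a\<^sup>2 = (1 - a) * (1 + a)" by (simp add: power2_eq_square algebra_simps)
  show "n_plus + n_minus = 2 * k * (1 + a\<^sup>2) / (1 - a\<^sup>2)" "n_minus - n_plus = - 4 * k * a / (1 - a\<^sup>2)"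
    unfolding f n_plus_def n_minus_def using nz
    by (simp_all add: divide_simps) (simp_all add: algebra_simps power2_eq_square)
qed

text \<open>
  The algebraic core. The quotient of \<open>second_factor\<close> and \<open>first_factor\<close> is \<open>x\<^sup>2\<close>, so both factors
  under the root in \<open>twist_rate\<close> are squares up to the common denominator. The first
  three identities compare quadratic polynomials in \<open>Z\<close>: the leading coefficients agree because
  \<open>n\<^sub>+ n\<^sub>- = k\<^sup>2\<close>, the linear ones by the values of \<open>M\<close>, \<open>n\<^sub>+ + n\<^sub>-\<close> and \<open>\<nu> M\<close>. The fourth amounts to
  \<open>\<nu> M = a (n\<^sub>- - n\<^sub>+)\<close>; it has no constant term since \<open>\<nu> S\<close> vanishes at \<open>Z = 0\<close>.
\<close>

lemma
  assumes "0 \<le> Z" "Z \<le> 1"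
  shows one_minus_S: "1 - M * Z / D Z = (1 - Z) * (1 - k\<^sup>2 * Z) / D Z"
    and first_factor: "1 - \<nu> * (M * Z / D Z) = (1 - k * Z)\<^sup>2 / D Z"
    and second_factor: "a\<^sup>2 - \<nu> * (M * Z / D Z) = (a * (1 + k * Z))\<^sup>2 / D Z"
    and partial_fractions:
      "\<nu> * (M * Z / D Z) = a * (1 / (1 - n_minus * Z) - 1 / (1 - n_plus * Z))"
proof -
  have D0: "D Z \<noteq> 0" using D_pos[OF assms] by simp
  have a0: "1 - a\<^sup>2 \<noteq> 0" using squares_less by simp
  have "D Z - M * Z = (1 - Z) * (1 - k\<^sup>2 * Z)"
    unfolding M_def D_poly by (simp add: algebra_simps power2_eq_square)
  then show "1 - M * Z / D Z = (1 - Z) * (1 - k\<^sup>2 * Z) / D Z"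
    using D0 by (simp add: field_simps)
  have "D Z - \<nu> * M * Z = (1 - k * Z)\<^sup>2"
    unfolding D_poly n_sum nu_M using a0
    by (simp add: divide_simps) (simp add: algebra_simps power2_eq_square)
  then show "1 - \<nu> * (M * Z / D Z) = (1 - k * Z)\<^sup>2 / D Z"
    using D0 by (simp add: field_simps)
  have "a\<^sup>2 * D Z - \<nu> * M * Z = (a * (1 + k * Z))\<^sup>2"
    unfolding D_poly n_sum nu_M using a0
    by (simp add: divide_simps) (simp add: algebra_simps power2_eq_square)
  then show "a\<^sup>2 - \<nu> * (M * Z / D Z) = (a * (1 + k * Z))\<^sup>2 / D Z"
    using D0 by (simp add: field_simps)
  have nz: "1 - n_minus * Z \<noteq> 0" "1 - n_plus * Z \<noteq> 0"
    using D0 unfolding D_def by auto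
  have "1 / (1 - n_minus * Z) - 1 / (1 - n_plus * Z) = (n_minus - n_plus) * Z / D Z"
    unfolding D_def using nz by (simp add: divide_simps) (simp add: algebra_simps)
  moreover have "\<nu> * M = a * (n_minus - n_plus)"
    unfolding nu_M n_diff by (simp add: power2_eq_square)
  ultimately show "\<nu> * (M * Z / D Z) = a * (1 / (1 - n_minus * Z) - 1 / (1 - n_plus * Z))"
    by (simp flip: mult.assoc)
qed

lemma modulus_pos: "0 < 1 - k\<^sup>2 * (sin \<alpha>)\<^sup>2"
  using k2_bounds by (intro factor_pos) (auto simp: abs_square_le_1)

lemma D_sin_pos: "0 < D ((sin \<alpha>)\<^sup>2)"
  by (intro D_pos) (auto simp: abs_square_le_1)

lemma continuous_on_landen_sine: "continuous_on A landen_sine"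
proof -
  have "continuous_on A (\<lambda>\<alpha>. D ((sin \<alpha>)\<^sup>2))"
    unfolding D_def by (intro continuous_intros)
  then show ?thesis
    unfolding landen_sine_def using D_sin_pos
    by (intro continuous_intros) (auto simp: less_imp_neq[THEN not_sym])
qed

lemma landen_sine_sq: "(landen_sine \<alpha>)\<^sup>2 = M * (sin \<alpha>)\<^sup>2 / D ((sin \<alpha>)\<^sup>2)"
  unfolding landen_sine_def using M_pos D_sin_pos[of \<alpha>]
  by (simp add: power_divide power_mult_distrib)

lemma one_minus_landen_sine_sq:
  "1 - (landen_sine \<alpha>)\<^sup>2 = (cos \<alpha>)\<^sup>2 * (1 - k\<^sup>2 * (sin \<alpha>)\<^sup>2) / D ((sin \<alpha>)\<^sup>2)"
  unfolding landen_sine_sq by (subst one_minus_S) (simp_all add: abs_square_le_1 cos_squared_eq)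

lemma landen_sine_bounds: "- 1 \<le> landen_sine \<alpha>" "landen_sine \<alpha> \<le> 1"
proof -
  have "0 \<le> 1 - (landen_sine \<alpha>)\<^sup>2"
    unfolding one_minus_landen_sine_sq using modulus_pos[of \<alpha>] D_sin_pos[of \<alpha>] by simp
  then have "\<bar>landen_sine \<alpha>\<bar> \<le> 1" by (simp add: abs_square_le_1)
  then show "- 1 \<le> landen_sine \<alpha>" "landen_sine \<alpha> \<le> 1" by auto
qed

lemma sin_landen_angle_sq: "(sin (landen_angle \<alpha>))\<^sup>2 = M * (sin \<alpha>)\<^sup>2 / D ((sin \<alpha>)\<^sup>2)"
  unfolding landen_angle_def using landen_sine_bounds by (simp add: landen_sine_sq)

lemma landen_angle_0: "landen_angle 0 = 0"
  by (simp add: landen_angle_def landen_sine_def)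

lemma landen_angle_pi_half: "landen_angle (pi/2) = pi/2"
  unfolding landen_angle_def landen_sine_def using M_pos by (simp add: M_def)

lemma landen_angle_range: "0 \<le> \<alpha> \<Longrightarrow> \<alpha> \<le> pi/2 \<Longrightarrow> landen_angle \<alpha> \<in> {0..pi/2}"
proof -
  assume "0 \<le> \<alpha>" "\<alpha> \<le> pi/2"
  then have "0 \<le> landen_sine \<alpha>"
    unfolding landen_sine_def using M_pos D_sin_pos[of \<alpha>] sin_ge_zero[of \<alpha>] by simp
  then show ?thesis
    using arcsin_le_arcsin[of 0 "landen_sine \<alpha>"] arcsin_ubound[of "landen_sine \<alpha>"]
      landen_sine_bounds[of \<alpha>]
    by (simp add: landen_angle_def)
qed

lemma continuous_on_landen_angle: "continuous_on A landen_angle"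
  unfolding landen_angle_def using landen_sine_bounds
  by (intro continuous_intros continuous_on_landen_sine) auto

text \<open>
  The right endpoint is excluded because \<open>landen_sine\<close> reaches 1 there, where \<open>arcsin\<close> is not
  differentiable. The cosines of numerator and denominator cancel, so the formula itself stays regular.
\<close>

lemma landen_angle_deriv:
  assumes "0 \<le> \<alpha>" "\<alpha> < pi/2"
  defines "Z \<equiv> (sin \<alpha>)\<^sup>2"
  shows "(landen_angle has_real_derivative
    sqrt M * (1 - k\<^sup>2 * Z\<^sup>2) / (D Z * sqrt (1 - k\<^sup>2 * Z))) (at \<alpha>)"
proof -
  have c: "0 < cos \<alpha>" using assms by (intro cos_gt_zero_pi) auto
  have Dp: "0 < D Z" and mp: "0 < 1 - k\<^sup>2 * Z" unfolding Z_def by (rule D_sin_pos modulus_pos)+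
  have root: "sqrt (1 - (landen_sine \<alpha>)\<^sup>2) = cos \<alpha> * sqrt (1 - k\<^sup>2 * Z) / sqrt (D Z)"
    unfolding one_minus_landen_sine_sq Z_def using c
    by (simp add: real_sqrt_mult real_sqrt_divide)
  have "0 < sqrt (1 - (landen_sine \<alpha>)\<^sup>2)" unfolding root using c Dp mp by simp
  then have "(landen_sine \<alpha>)\<^sup>2 < 1" by simp
  then have "\<bar>landen_sine \<alpha>\<bar> < 1" by (simp add: abs_square_less_1)
  then have q1: "-1 < landen_sine \<alpha>" "landen_sine \<alpha> < 1" by auto
  have dD: "((\<lambda>\<alpha>. D ((sin \<alpha>)\<^sup>2)) has_real_derivative
      (2 * k\<^sup>2 * Z - (n_plus + n_minus)) * (2 * sin \<alpha> * cos \<alpha>)) (at \<alpha>)"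
    unfolding D_poly Z_def by (auto intro!: derivative_eq_intros simp: algebra_simps power2_eq_square)
  have "(landen_sine has_real_derivative
      (sqrt M * cos \<alpha> * sqrt (D Z) - sqrt M * sin \<alpha> *
        ((2 * k\<^sup>2 * Z - (n_plus + n_minus)) * (2 * sin \<alpha> * cos \<alpha>) * (inverse (sqrt (D Z)) / 2)))
      / (sqrt (D Z) * sqrt (D Z))) (at \<alpha>)"
    unfolding landen_sine_def using Dp unfolding Z_def
    by (auto intro!: derivative_eq_intros dD[unfolded Z_def] simp: mult_ac)
  also have "(sqrt M * cos \<alpha> * sqrt (D Z) - sqrt M * sin \<alpha> *
        ((2 * k\<^sup>2 * Z - (n_plus + n_minus)) * (2 * sin \<alpha> * cos \<alpha>) * (inverse (sqrt (D Z)) / 2)))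
      / (sqrt (D Z) * sqrt (D Z))
    = sqrt M * cos \<alpha> * (D Z - Z * (2 * k\<^sup>2 * Z - (n_plus + n_minus))) / (D Z * sqrt (D Z))"
  proof -
    have s: "sqrt (D Z) * sqrt (D Z) = D Z" "sqrt (D Z) \<noteq> 0" using Dp by simp_all
    have Z: "sin \<alpha> * sin \<alpha> = Z" by (simp add: Z_def power2_eq_square)
    define r where "r = sqrt (D Z)"
    have "(sqrt M * cos \<alpha> * r - sqrt M * sin \<alpha> *
        ((2 * k\<^sup>2 * Z - (n_plus + n_minus)) * (2 * sin \<alpha> * cos \<alpha>) * (inverse r / 2))) / (r * r)
      = sqrt M * cos \<alpha> * (r * r - (sin \<alpha> * sin \<alpha>) * (2 * k\<^sup>2 * Z - (n_plus + n_minus))) / (r * r * r)"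
      using s unfolding r_def[symmetric] by (simp add: divide_simps) (simp add: algebra_simps)
    then show ?thesis unfolding Z r_def s .
  qed
  \<comment> \<open>The linear terms in \<open>Z\<close> cancel, and with them the sum \<open>n\<^sub>+ + n\<^sub>-\<close>.\<close>
  also have "D Z - Z * (2 * k\<^sup>2 * Z - (n_plus + n_minus)) = 1 - k\<^sup>2 * Z\<^sup>2"
    unfolding D_poly by (simp add: algebra_simps power2_eq_square)
  finally have dq: "(landen_sine has_real_derivative
      sqrt M * cos \<alpha> * (1 - k\<^sup>2 * Z\<^sup>2) / (D Z * sqrt (D Z))) (at \<alpha>)" .
  have "((\<lambda>\<alpha>. arcsin (landen_sine \<alpha>)) has_real_derivative
      inverse (sqrt (1 - (landen_sine \<alpha>)\<^sup>2)) * (sqrt M * cos \<alpha> * (1 - k\<^sup>2 * Z\<^sup>2) / (D Z * sqrt (D Z)))) (at \<alpha>)"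
    by (rule DERIV_chain2[OF DERIV_arcsin[OF q1] dq])
  also have "inverse (sqrt (1 - (landen_sine \<alpha>)\<^sup>2)) * (sqrt M * cos \<alpha> * (1 - k\<^sup>2 * Z\<^sup>2) / (D Z * sqrt (D Z)))
      = sqrt M * (1 - k\<^sup>2 * Z\<^sup>2) / (D Z * sqrt (1 - k\<^sup>2 * Z))"
    unfolding root using c Dp mp by (simp add: divide_simps)
  finally show ?thesis unfolding landen_angle_def .
qed

lemma rate_pos: "0 \<le> S \<Longrightarrow> 0 < twist_rate a \<nu> S"
  using nu_neg a_pos by (intro twist_rate_pos) auto

lemma rate_landen_angle:
  "twist_rate a \<nu> ((sin (landen_angle \<alpha>))\<^sup>2) = a * (1 - k\<^sup>2 * ((sin \<alpha>)\<^sup>2)\<^sup>2) / D ((sin \<alpha>)\<^sup>2)"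
proof -
  define Z where "Z = (sin \<alpha>)\<^sup>2"
  have Z: "0 \<le> Z" "Z \<le> 1" by (auto simp: Z_def abs_square_le_1)
  have kZ: "0 < 1 - k * Z" "0 \<le> k * Z" using k_bounds Z by (simp_all add: factor_pos del: diff_gt_0_iff_gt)
  have "twist_rate a \<nu> ((sin (landen_angle \<alpha>))\<^sup>2) = sqrt (((1 - k * Z) * (a * (1 + k * Z)) / D Z)\<^sup>2)"
    unfolding twist_rate_def sin_landen_angle_sq Z_def[symmetric]
      first_factor[OF Z] second_factor[OF Z]
    by (simp add: power2_eq_square mult_ac)
  also have "\<dots> = (1 - k * Z) * (a * (1 + k * Z)) / D Z"
    using kZ a_pos D_pos[OF Z] by simp
  also have "\<dots> = a * (1 - k\<^sup>2 * Z\<^sup>2) / D Z"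
    by (simp add: algebra_simps power2_eq_square)
  finally show ?thesis by (simp add: Z_def)
qed

text \<open>
  The factor \<open>1 - k\<^sup>2 Z\<^sup>2\<close> and the denominator \<open>D Z\<close> occur both in the derivative of the substitution
  and in the transformed rate, so the quotient is just \<open>sqrt M / a\<close> over \<open>sqrt (1 - k\<^sup>2 Z)\<close>. The free
  function \<open>h\<close> of \<open>sin\<^sup>2 \<psi>\<close> serves the period (\<open>h = 1\<close>) and the somersault (\<open>h S = \<nu> S\<close>) at once.
\<close>

lemma landen_substitution:
  assumes "continuous_on {0..1} h"
  shows "((\<lambda>\<alpha>. 2 / ((a + b) * sqrt (1 - \<nu>)) *
        (h (M * (sin \<alpha>)\<^sup>2 / D ((sin \<alpha>)\<^sup>2)) / sqrt (1 - k\<^sup>2 * (sin \<alpha>)\<^sup>2)))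
      has_integral integral {0..pi/2} (\<lambda>\<psi>. h ((sin \<psi>)\<^sup>2) / twist_rate a \<nu> ((sin \<psi>)\<^sup>2))) {0..pi/2}"
proof -
  define f where "f = (\<lambda>\<psi>. h ((sin \<psi>)\<^sup>2) / twist_rate a \<nu> ((sin \<psi>)\<^sup>2))"
  define g' where "g' = (\<lambda>\<alpha>. sqrt M * (1 - k\<^sup>2 * ((sin \<alpha>)\<^sup>2)\<^sup>2)
      / (D ((sin \<alpha>)\<^sup>2) * sqrt (1 - k\<^sup>2 * (sin \<alpha>)\<^sup>2)))"
  have R0: "twist_rate a \<nu> ((sin \<psi>)\<^sup>2) \<noteq> 0" for \<psi> using rate_pos[of "(sin \<psi>)\<^sup>2"] by simp
  have "continuous_on {0..pi/2} (\<lambda>\<psi>. h ((sin \<psi>)\<^sup>2))"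
    by (rule continuous_on_compose2[OF assms])
       (auto intro!: continuous_intros simp: abs_square_le_1)
  then have f: "continuous_on {0..pi/2} f"
    unfolding f_def using R0
    by (intro continuous_on_divide) (auto intro!: continuous_intros simp: twist_rate_def)
  have "((\<lambda>\<alpha>. g' \<alpha> *\<^sub>R f (landen_angle \<alpha>))
      has_integral integral {landen_angle 0..landen_angle (pi/2)} f) {0..pi/2}"
  proof (rule has_integral_substitution_strong[of "{pi/2}" _ _ _ 0 "pi/2"])
    show "(landen_angle has_real_derivative g' \<alpha>) (at \<alpha> within {0..pi/2})"
      if "\<alpha> \<in> {0..pi/2} - {pi/2}" for \<alpha>
      using landen_angle_deriv[of \<alpha>] that unfolding g'_def
      by (auto intro: has_field_derivative_at_within)
  qed (use landen_angle_range f continuous_on_landen_angle landen_angle_0 landen_angle_pi_half in auto)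
  moreover have "g' \<alpha> *\<^sub>R f (landen_angle \<alpha>) = 2 / ((a + b) * sqrt (1 - \<nu>)) *
        (h (M * (sin \<alpha>)\<^sup>2 / D ((sin \<alpha>)\<^sup>2)) / sqrt (1 - k\<^sup>2 * (sin \<alpha>)\<^sup>2))" for \<alpha>
  proof -
    have "twist_rate a \<nu> ((sin (landen_angle \<alpha>))\<^sup>2) \<noteq> 0" by (rule R0)
    then have nz: "1 - k\<^sup>2 * ((sin \<alpha>)\<^sup>2)\<^sup>2 \<noteq> 0" "D ((sin \<alpha>)\<^sup>2) \<noteq> 0" "a \<noteq> 0"
      unfolding rate_landen_angle using a_pos by auto
    have "g' \<alpha> *\<^sub>R f (landen_angle \<alpha>) = sqrt M / a *
        (h (M * (sin \<alpha>)\<^sup>2 / D ((sin \<alpha>)\<^sup>2)) / sqrt (1 - k\<^sup>2 * (sin \<alpha>)\<^sup>2))"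
      unfolding g'_def f_def rate_landen_angle unfolding sin_landen_angle_sq using nz by simp
    also have "sqrt M / a = 2 / ((a + b) * sqrt (1 - \<nu>))"
      unfolding sqrt_M using nz by simp
    finally show ?thesis .
  qed
  ultimately show ?thesis unfolding f_def landen_angle_0 landen_angle_pi_half by simp
qed

lemma integral_eq_ellipticK:
  "integral {0..pi/2} (\<lambda>\<psi>. 1 / twist_rate a \<nu> ((sin \<psi>)\<^sup>2))
    = 2 / ((a + b) * sqrt (1 - \<nu>)) * ellipticK (k\<^sup>2)"
  using integral_unique[OF landen_substitution[of "\<lambda>_. 1"]]
  unfolding ellipticK_def integral_mult_right by simp

lemma ellipticPi_integrable:
  assumes "0 \<le> n" "n < 1"
  shows "(\<lambda>\<alpha>. 1 / ((1 - n * (sin \<alpha>)\<^sup>2) * sqrt (1 - k\<^sup>2 * (sin \<alpha>)\<^sup>2))) integrable_on {0..pi/2}"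
proof (intro integrable_continuous_real continuous_intros ballI)
  fix \<alpha> :: real
  have "0 < 1 - n * (sin \<alpha>)\<^sup>2" using assms by (intro factor_pos) (auto simp: abs_square_le_1)
  then show "(1 - n * (sin \<alpha>)\<^sup>2) * sqrt (1 - k\<^sup>2 * (sin \<alpha>)\<^sup>2) \<noteq> 0"
    using modulus_pos[of \<alpha>] by simp
qed

lemma integral_eq_ellipticPi_diff:
  "integral {0..pi/2} (\<lambda>\<psi>. \<nu> * (sin \<psi>)\<^sup>2 / twist_rate a \<nu> ((sin \<psi>)\<^sup>2))
    = 2 * a / ((a + b) * sqrt (1 - \<nu>)) * (ellipticPi n_minus (k\<^sup>2) - ellipticPi n_plus (k\<^sup>2))"
proof -
  have split: "2 / ((a + b) * sqrt (1 - \<nu>)) *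
        (\<nu> * (M * (sin \<alpha>)\<^sup>2 / D ((sin \<alpha>)\<^sup>2)) / sqrt (1 - k\<^sup>2 * (sin \<alpha>)\<^sup>2))
      = 2 * a / ((a + b) * sqrt (1 - \<nu>)) *
        (1 / ((1 - n_minus * (sin \<alpha>)\<^sup>2) * sqrt (1 - k\<^sup>2 * (sin \<alpha>)\<^sup>2))
         - 1 / ((1 - n_plus * (sin \<alpha>)\<^sup>2) * sqrt (1 - k\<^sup>2 * (sin \<alpha>)\<^sup>2)))" for \<alpha>
  proof -
    have algebra: "2 / c * (a * (1 / A - 1 / B) / s) = 2 * a / c * (1 / (A * s) - 1 / (B * s))"
      for A B c s :: real
      by (simp add: divide_inverse algebra_simps)
    have "(sin \<alpha>)\<^sup>2 \<le> 1" by (simp add: abs_square_le_1)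
    from partial_fractions[OF zero_le_power2 this] show ?thesis
      by (simp only: algebra)
  qed
  have "integral {0..pi/2} (\<lambda>\<psi>. \<nu> * (sin \<psi>)\<^sup>2 / twist_rate a \<nu> ((sin \<psi>)\<^sup>2))
      = integral {0..pi/2} (\<lambda>\<alpha>. 2 / ((a + b) * sqrt (1 - \<nu>)) *
        (\<nu> * (M * (sin \<alpha>)\<^sup>2 / D ((sin \<alpha>)\<^sup>2)) / sqrt (1 - k\<^sup>2 * (sin \<alpha>)\<^sup>2)))"
    by (rule integral_unique[OF landen_substitution, symmetric]) (intro continuous_intros)
  then show ?thesis
    unfolding split integral_mult_right ellipticPi_def
    using ellipticPi_integrable n_bounds by (subst (asm) integral_diff) (auto simp: less_imp_le)
qed

end

section \<open>Two facts about real functions, and times of a prescribed twist\<close>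

text \<open>
  Gronwall's argument in both time directions: \<open>(u - c)\<^sup>2\<close> damped by \<open>exp (- 2 C t)\<close> is nonincreasing,
  and amplified by \<open>exp (2 C t)\<close> it is nondecreasing. It excludes the separatrix.
\<close>

lemma stays_at_rest_point:
  fixes u u' :: "real \<Rightarrow> real"
  assumes deriv: "\<And>t. (u has_real_derivative u' t) (at t)"
    and bound: "\<And>t. \<bar>u' t\<bar> \<le> C * \<bar>u t - c\<bar>"
    and start: "u t0 = c"
  shows "u t = c"
proof -
  define v where "v = (\<lambda>t. (u t - c)\<^sup>2)"
  have dv: "((\<lambda>t. v t * exp (r * t)) has_real_derivative
      (2 * (u t - c) * u' t + r * v t) * exp (r * t)) (at t)" for r t
    unfolding v_def by (auto intro!: derivative_eq_intros deriv simp: algebra_simps)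
  have growth: "\<bar>2 * (u t - c) * u' t\<bar> \<le> 2 * C * v t" for t
  proof -
    have "\<bar>2 * (u t - c) * u' t\<bar> = 2 * \<bar>u t - c\<bar> * \<bar>u' t\<bar>" unfolding abs_mult by simp
    also have "\<dots> \<le> 2 * \<bar>u t - c\<bar> * (C * \<bar>u t - c\<bar>)"
      by (intro mult_left_mono bound) simp
    also have "\<dots> = 2 * C * v t" by (simp add: v_def power2_eq_square)
    finally show ?thesis .
  qed
  have v0: "v t0 = 0" unfolding v_def start by simp
  have "v t \<le> 0"
  proof (cases "t0 \<le> t")
    case True
    have "v t * exp (- 2 * C * t) \<le> v t0 * exp (- 2 * C * t0)"
    proof (rule DERIV_nonpos_imp_nonincreasing[OF True], intro exI conjI)
      fix x
      show "((\<lambda>t. v t * exp (- 2 * C * t)) has_real_derivative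
          (2 * (u x - c) * u' x + (- 2 * C) * v x) * exp (- 2 * C * x)) (at x)"
        by (rule dv)
      show "(2 * (u x - c) * u' x + (- 2 * C) * v x) * exp (- 2 * C * x) \<le> 0"
        using growth[of x] by (intro mult_nonpos_nonneg) (auto simp: abs_le_iff)
    qed
    then show ?thesis unfolding v0 by (simp add: mult_le_0_iff)
  next
    case False
    then have le: "t \<le> t0" by simp
    have "v t * exp (2 * C * t) \<le> v t0 * exp (2 * C * t0)"
    proof (rule DERIV_nonneg_imp_nondecreasing[OF le], intro exI conjI)
      fix x
      show "((\<lambda>t. v t * exp (2 * C * t)) has_real_derivative
          (2 * (u x - c) * u' x + (2 * C) * v x) * exp (2 * C * x)) (at x)"
        by (rule dv)
      show "0 \<le> (2 * (u x - c) * u' x + (2 * C) * v x) * exp (2 * C * x)"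
        using growth[of x] by (intro mult_nonneg_nonneg) (auto simp: abs_le_iff)
    qed
    then show ?thesis unfolding v0 by (simp add: mult_le_0_iff)
  qed
  then show ?thesis by (simp add: v_def)
qed

text \<open>
  Four quarter turns contribute equally: \<open>F\<close> grows by the same amount over all intervals of length
  \<open>\<pi>\<close>, and the increment over the one centred at 0 splits into equal halves because \<open>F - F 0\<close> is odd.
\<close>

lemma antiderivative_full_turn:
  fixes f :: "real \<Rightarrow> real"
  assumes cont: "continuous_on UNIV f"
    and periodic: "\<And>y. f (y + pi) = f y" and even: "\<And>y. f (- y) = f y"
  obtains F where "\<And>y. (F has_real_derivative f y) (at y)"
    and "\<And>y. F (y + 2 * pi) - F y = 4 * integral {0..pi/2} f"
proof -
  have "isCont f x" for x using cont by (simp add: continuous_on_eq_continuous_at)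
  then obtain F where F: "(F has_real_derivative f y) (at y)" for y
    using einterval_antiderivative[of "-\<infinity>" "\<infinity>" f]
    by (auto simp: has_real_derivative_iff_has_vector_derivative)
  have shift: "((\<lambda>y. F (y + pi) - F y) has_real_derivative 0) (at y)" for y
    using DERIV_diff[OF F[of "y + pi", unfolded DERIV_shift] F[of y]] by (simp add: periodic)
  have "((\<lambda>y. F (- y) + F y) has_real_derivative 0) (at y)" for y
    using DERIV_add[OF DERIV_chain2[OF F DERIV_minus[OF DERIV_ident]] F[of y]] by (simp add: even)
  then have reflect: "F (- y) + F y = F (- 0) + F 0" for y
    by (intro DERIV_isconst_all[of "\<lambda>y. F (- y) + F y"] allI)
  have half: "F (y + pi) - F y = F (z + pi) - F z" for y z
    using DERIV_isconst_all[of "\<lambda>y. F (y + pi) - F y"] shift by blast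
  have "F (pi/2) - F 0 = integral {0..pi/2} f"
    by (rule integral_unique[symmetric], rule fundamental_theorem_of_calculus)
       (auto intro: has_field_derivative_at_within F
          simp flip: has_real_derivative_iff_has_vector_derivative)
  moreover have "F (y + 2 * pi) - F y = 4 * (F (pi/2) - F 0)" for y
    using half[of y "- (pi/2)"] half[of "y + pi" "- (pi/2)"] reflect[of "pi/2"]
    by (simp add: algebra_simps)
  ultimately show ?thesis using that[OF F] by simp
qed

text \<open>
  The values of \<open>\<psi>\<close> on a full turn fill an interval of length \<open>2 \<pi>\<close>, so they meet every residue class
  modulo \<open>2 \<pi>\<close>. This supplies times with \<open>sin \<psi> = 0\<close> and with \<open>sin \<psi> = 1\<close>.
\<close>

lemma twisting_hits:
  assumes "twisting \<psi>" and "continuous_on UNIV \<psi>"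
  obtains \<tau> m where "\<psi> \<tau> = y + 2 * pi * of_int m"
proof -
  from assms(1) obtain \<tau>1 \<tau>2 where \<tau>: "\<tau>1 < \<tau>2" "\<psi> \<tau>2 = \<psi> \<tau>1 + 2 * pi"
    unfolding twisting_def by blast
  define m where "m = \<lceil>(\<psi> \<tau>1 - y) / (2 * pi)\<rceil>"
  have "(\<psi> \<tau>1 - y) / (2 * pi) \<le> of_int m" "of_int m \<le> (\<psi> \<tau>1 - y) / (2 * pi) + 1"
    unfolding m_def by linarith+
  then have "\<psi> \<tau>1 \<le> y + 2 * pi * of_int m" "y + 2 * pi * of_int m \<le> \<psi> \<tau>2"
    using \<tau>(2) by (simp_all add: field_simps)
  then obtain \<tau> where "\<psi> \<tau> = y + 2 * pi * of_int m"
    using IVT'[of \<psi> \<tau>1 _ \<tau>2] \<tau>(1) continuous_on_subset[OF assms(2)]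
    by (metis less_imp_le subset_UNIV)
  then show ?thesis by (rule that)
qed

section \<open>Twisting motion of the rigid body\<close>

locale twisting_motion =
  fixes \<delta> \<gamma> \<nu> :: real and \<phi> \<theta> \<psi> :: "real \<Rightarrow> real"
  assumes delta_neg: "\<delta> < 0" and gamma_pos: "0 < \<gamma>"
    and nu_def: "\<nu> = \<delta> / \<gamma>"
    and motion: "rotor_off_motion \<delta> \<gamma> \<phi> \<theta> \<psi>"
    and twisting: "twisting \<psi>"
begin

lemma nu_neg: "\<nu> < 0"
  using delta_neg gamma_pos by (simp add: nu_def divide_neg_pos)

lemma delta_eq: "\<delta> = \<gamma> * \<nu>"
  using gamma_pos by (simp add: nu_def)

lemma one_minus_nu_S: "1 \<le> 1 - \<nu> * (sin y)\<^sup>2" "1 - \<nu> * (sin y)\<^sup>2 \<le> 1 - \<nu>"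
proof -
  show "1 \<le> 1 - \<nu> * (sin y)\<^sup>2" using nu_neg by (simp add: mult_nonpos_nonneg)
  have "- \<nu> * (sin y)\<^sup>2 \<le> - \<nu> * 1"
    using nu_neg by (intro mult_left_mono) (auto simp: abs_square_le_1)
  then show "1 - \<nu> * (sin y)\<^sup>2 \<le> 1 - \<nu>" by simp
qed

lemma phi_deriv: "(\<phi> has_real_derivative 1 + \<gamma> * (\<nu> * (sin (\<psi> \<tau>))\<^sup>2)) (at \<tau>)"
  using motion unfolding rotor_off_motion_def delta_eq by (simp add: mult.assoc)

lemma theta_deriv:
  "(\<theta> has_real_derivative - (\<gamma> * \<nu> * cos (\<theta> \<tau>) * cos (\<psi> \<tau>) * sin (\<psi> \<tau>))) (at \<tau>)"
  using motion unfolding rotor_off_motion_def delta_eq by simp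

lemma psi_deriv:
  "(\<psi> has_real_derivative \<gamma> * sin (\<theta> \<tau>) * (1 - \<nu> * (sin (\<psi> \<tau>))\<^sup>2)) (at \<tau>)"
  using motion unfolding rotor_off_motion_def delta_eq by (simp add: algebra_simps)

lemma theta_range: "- (pi/2) < \<theta> \<tau>" "\<theta> \<tau> < pi/2"
  using motion unfolding rotor_off_motion_def by auto

lemma continuous_on_psi: "continuous_on A \<psi>" and continuous_on_theta: "continuous_on A \<theta>"
  by (intro continuous_at_imp_continuous_on ballI DERIV_isCont[OF psi_deriv] DERIV_isCont[OF theta_deriv])+

lemma energy_conserved:
  "(sin (\<theta> \<tau>))\<^sup>2 + \<nu> * ((cos (\<theta> \<tau>))\<^sup>2 * (sin (\<psi> \<tau>))\<^sup>2)
    = (sin (\<theta> \<tau>'))\<^sup>2 + \<nu> * ((cos (\<theta> \<tau>'))\<^sup>2 * (sin (\<psi> \<tau>'))\<^sup>2)"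
proof (rule DERIV_isconst_all[where f =
      "\<lambda>\<tau>. (sin (\<theta> \<tau>))\<^sup>2 + \<nu> * ((cos (\<theta> \<tau>))\<^sup>2 * (sin (\<psi> \<tau>))\<^sup>2)"], intro allI)
  fix \<tau>
  show "((\<lambda>\<tau>. (sin (\<theta> \<tau>))\<^sup>2 + \<nu> * ((cos (\<theta> \<tau>))\<^sup>2 * (sin (\<psi> \<tau>))\<^sup>2)) has_real_derivative 0) (at \<tau>)"
    by (rule derivative_eq_intros theta_deriv psi_deriv refl)+
       (simp add: algebra_simps power2_eq_square)
qed

text \<open>
  Twisting excludes \<open>a = 0\<close> and determines the sign of the tilt. For \<open>a = 0\<close> the integral gives
  \<open>\<bar>sin \<theta>\<bar> \<le> sqrt (- \<nu>) \<bar>sin \<psi>\<bar>\<close>, hence a linear bound on \<open>\<psi>'\<close> near a rest point that \<open>\<psi>\<close> attains.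
  For \<open>a > 0\<close> the right-hand side of the integral is positive, so \<open>sin \<theta>\<close> has constant sign, and some
  time on a forward turn has \<open>\<psi>' > 0\<close>.
\<close>

lemma twist_integral:
  obtains a where "0 < a" "\<And>\<tau>. 0 < sin (\<theta> \<tau>)"
    and "\<And>\<tau>. (sin (\<theta> \<tau>))\<^sup>2 * (1 - \<nu> * (sin (\<psi> \<tau>))\<^sup>2) = a\<^sup>2 - \<nu> * (sin (\<psi> \<tau>))\<^sup>2"
proof -
  obtain \<tau>0 m where "\<psi> \<tau>0 = 0 + 2 * pi * of_int m"
    using twisting_hits[OF twisting continuous_on_psi] by blast
  then have \<tau>0: "\<psi> \<tau>0 = pi * of_int (2 * m)" by simp
  then have s0: "sin (\<psi> \<tau>0) = 0" by (simp only: sin_npi_int)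
  define a where "a = \<bar>sin (\<theta> \<tau>0)\<bar>"
  have integral: "(sin (\<theta> \<tau>))\<^sup>2 * (1 - \<nu> * (sin (\<psi> \<tau>))\<^sup>2) = a\<^sup>2 - \<nu> * (sin (\<psi> \<tau>))\<^sup>2" for \<tau>
    using energy_conserved[of \<tau> \<tau>0] by (simp add: s0 a_def cos_squared_eq algebra_simps)
  from twisting obtain \<tau>1 \<tau>2 where turn: "\<tau>1 < \<tau>2" "\<psi> \<tau>2 = \<psi> \<tau>1 + 2 * pi"
    unfolding twisting_def by blast
  have "a \<noteq> 0"
  proof
    assume a0: "a = 0"
    have "\<bar>\<gamma> * sin (\<theta> \<tau>) * (1 - \<nu> * (sin (\<psi> \<tau>))\<^sup>2)\<bar> \<le> \<gamma> * sqrt (- \<nu>) * (1 - \<nu>) * \<bar>\<psi> \<tau> - \<psi> \<tau>0\<bar>" for \<tau>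
    proof -
      note w = one_minus_nu_S[of "\<psi> \<tau>"]
      have "(sin (\<theta> \<tau>))\<^sup>2 * 1 \<le> (sin (\<theta> \<tau>))\<^sup>2 * (1 - \<nu> * (sin (\<psi> \<tau>))\<^sup>2)"
        using w by (intro mult_left_mono) auto
      also have "\<dots> = (sqrt (- \<nu>) * sin (\<psi> \<tau>))\<^sup>2"
        unfolding integral a0 using nu_neg by (simp add: power_mult_distrib)
      finally have "\<bar>sin (\<theta> \<tau>)\<bar> \<le> sqrt (- \<nu>) * \<bar>sin (\<psi> \<tau>)\<bar>"
        unfolding mult_1_right abs_le_square_iff[symmetric] using nu_neg by (simp add: abs_mult)
      also have "\<bar>sin (\<psi> \<tau>)\<bar> = \<bar>sin (\<psi> \<tau> - \<psi> \<tau>0)\<bar>"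
        unfolding sin_diff s0 using sin_cos_squared_add[of "\<psi> \<tau>0"]
        by (auto simp: s0 power2_eq_1_iff)
      also have "\<dots> \<le> \<bar>\<psi> \<tau> - \<psi> \<tau>0\<bar>" by (rule abs_sin_x_le_abs_x)
      finally have s: "\<bar>sin (\<theta> \<tau>)\<bar> \<le> sqrt (- \<nu>) * \<bar>\<psi> \<tau> - \<psi> \<tau>0\<bar>"
        using nu_neg by (simp add: mult_left_mono)
      have "\<bar>sin (\<theta> \<tau>)\<bar> * (1 - \<nu> * (sin (\<psi> \<tau>))\<^sup>2) \<le> (sqrt (- \<nu>) * \<bar>\<psi> \<tau> - \<psi> \<tau>0\<bar>) * (1 - \<nu>)"
        using s w nu_neg by (intro mult_mono) auto
      then show ?thesis
        using gamma_pos w(1) by (simp add: abs_mult mult_ac)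
    qed
    from stays_at_rest_point[OF psi_deriv this refl]
    have "\<psi> \<tau>1 = \<psi> \<tau>0" "\<psi> \<tau>2 = \<psi> \<tau>0" by auto
    then show False using turn(2) by simp
  qed
  then have a: "0 < a" by (simp add: a_def)
  have nz: "sin (\<theta> \<tau>) \<noteq> 0" for \<tau>
    using integral[of \<tau>] one_minus_nu_S(1)[of "\<psi> \<tau>"] a zero_less_power[OF a, of 2]
    by (intro notI) (simp add: algebra_simps)
  obtain z where "\<psi> \<tau>2 - \<psi> \<tau>1 = (\<tau>2 - \<tau>1) * (\<gamma> * sin (\<theta> z) * (1 - \<nu> * (sin (\<psi> z))\<^sup>2))"
    using MVT2[OF turn(1) psi_deriv] by blast
  then have "0 < (\<tau>2 - \<tau>1) * (\<gamma> * sin (\<theta> z) * (1 - \<nu> * (sin (\<psi> z))\<^sup>2))"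
    using turn(2) pi_gt_zero by linarith
  then have z: "0 < sin (\<theta> z)"
    using turn(1) gamma_pos one_minus_nu_S(1)[of "\<psi> z"] by (simp add: zero_less_mult_iff)
  have cont: "continuous_on A (\<lambda>\<tau>. sin (\<theta> \<tau>))" for A
    by (intro continuous_intros continuous_on_theta)
  have "0 < sin (\<theta> \<tau>)" for \<tau>
  proof (rule ccontr)
    assume "\<not> 0 < sin (\<theta> \<tau>)"
    then have "\<exists>x. sin (\<theta> x) = 0"
      using IVT'[OF _ _ _ cont, of \<tau> 0 z] IVT2'[OF _ _ _ cont, of \<tau> 0 z] z
      by (cases "\<tau> \<le> z") (auto simp: not_less)
    then show False using nz by blast
  qed
  with a integral show ?thesis by (intro that)
qed

text \<open>
  By the integral \<open>sin\<^sup>2 \<theta> = (a\<^sup>2 - \<nu> S) / (1 - \<nu> S)\<close> with \<open>S = sin\<^sup>2 \<psi>\<close>, which increases with \<open>S\<close> as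
  \<open>\<nu> < 0\<close> and \<open>a < 1\<close>. Both ends \<open>S = 0\<close> and \<open>S = 1\<close> are attained, so infimum and supremum of \<open>\<theta>\<close>
  are its values there.
\<close>

lemma theta_extrema:
  assumes "0 < a" and pos: "\<And>\<tau>. 0 < sin (\<theta> \<tau>)"
    and integral: "\<And>\<tau>. (sin (\<theta> \<tau>))\<^sup>2 * (1 - \<nu> * (sin (\<psi> \<tau>))\<^sup>2) = a\<^sup>2 - \<nu> * (sin (\<psi> \<tau>))\<^sup>2"
  defines "b \<equiv> sin (theta_max \<theta>)"
  shows "sin (theta_min \<theta>) = a" "b\<^sup>2 + (1 - b\<^sup>2) * \<nu> = a\<^sup>2" "a < b" "b < 1"
proof -
  have mono: "\<theta> \<tau> \<le> \<theta> \<tau>' \<longleftrightarrow> (sin (\<theta> \<tau>))\<^sup>2 \<le> (sin (\<theta> \<tau>'))\<^sup>2" for \<tau> \<tau>'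
    using theta_range[of \<tau>] theta_range[of \<tau>'] pos[of \<tau>] pos[of \<tau>']
    by (subst sin_mono_le_eq[symmetric]) (auto simp: less_imp_le power_mono_iff)
  have a_lt_1: "a\<^sup>2 < 1"
  proof -
    have "\<theta> 0 < pi/2" "- (pi/2) < \<theta> 0" by (rule theta_range)+
    then have "sin (\<theta> 0) < sin (pi/2)" by (subst sin_mono_less_eq) auto
    then have "(sin (\<theta> 0))\<^sup>2 < 1" using pos[of 0] by (simp add: abs_square_less_1)
    then have "(sin (\<theta> 0))\<^sup>2 * (1 - \<nu> * (sin (\<psi> 0))\<^sup>2) < 1 * (1 - \<nu> * (sin (\<psi> 0))\<^sup>2)"
      using one_minus_nu_S(1)[of "\<psi> 0"] by (intro mult_strict_right_mono) auto
    then show ?thesis unfolding integral by simp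
  qed
  obtain \<tau>0 m where "\<psi> \<tau>0 = 0 + 2 * pi * of_int m"
    using twisting_hits[OF twisting continuous_on_psi] by blast
  then have s0: "sin (\<psi> \<tau>0) = 0" by simp
  obtain \<tau>1 m where "\<psi> \<tau>1 = pi/2 + 2 * pi * of_int m"
    using twisting_hits[OF twisting continuous_on_psi] by blast
  then have s1: "sin (\<psi> \<tau>1) = 1" by (simp add: sin_add)
  have x0: "(sin (\<theta> \<tau>0))\<^sup>2 = a\<^sup>2" using integral[of \<tau>0] by (simp add: s0)
  have x1: "(sin (\<theta> \<tau>1))\<^sup>2 * (1 - \<nu>) = a\<^sup>2 - \<nu>" using integral[of \<tau>1] by (simp add: s1)
  have lower: "a\<^sup>2 \<le> (sin (\<theta> \<tau>))\<^sup>2" for \<tau>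
  proof -
    have "a\<^sup>2 * (1 - \<nu> * (sin (\<psi> \<tau>))\<^sup>2) \<le> a\<^sup>2 - \<nu> * (sin (\<psi> \<tau>))\<^sup>2"
      using mult_left_mono[of "a\<^sup>2" 1 "- \<nu> * (sin (\<psi> \<tau>))\<^sup>2"] a_lt_1 nu_neg
      by (simp add: algebra_simps mult_nonneg_nonpos2)
    then show ?thesis
      unfolding integral[symmetric] using one_minus_nu_S(1)[of "\<psi> \<tau>"]
      by (simp only: mult_le_cancel_right)
  qed
  have upper: "(sin (\<theta> \<tau>))\<^sup>2 \<le> (sin (\<theta> \<tau>1))\<^sup>2" for \<tau>
  proof -
    define S where "S = (sin (\<psi> \<tau>))\<^sup>2"
    have S: "0 \<le> S" "S \<le> 1" by (auto simp: S_def abs_square_le_1)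
    have "0 \<le> - \<nu> * ((1 - a\<^sup>2) * (1 - S))"
      using nu_neg a_lt_1 S by (intro mult_nonneg_nonneg) auto
    then have "(a\<^sup>2 - \<nu> * S) * (1 - \<nu>) \<le> (a\<^sup>2 - \<nu>) * (1 - \<nu> * S)"
      by (simp add: algebra_simps)
    then have "(sin (\<theta> \<tau>))\<^sup>2 * ((1 - \<nu> * S) * (1 - \<nu>)) \<le> (sin (\<theta> \<tau>1))\<^sup>2 * ((1 - \<nu> * S) * (1 - \<nu>))"
      unfolding x1[symmetric] integral[of \<tau>, folded S_def, symmetric] by (simp add: mult_ac)
    moreover have "0 < (1 - \<nu> * S) * (1 - \<nu>)"
      using one_minus_nu_S(1)[of "\<psi> \<tau>"] nu_neg by (intro mult_pos_pos) (auto simp: S_def)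
    ultimately show ?thesis by (simp only: mult_le_cancel_right_pos)
  qed
  have "theta_min \<theta> = \<theta> \<tau>0"
    unfolding theta_min_def by (rule cInf_eq_minimum) (auto simp: mono x0 lower)
  then show "sin (theta_min \<theta>) = a"
    using x0 pos[of \<tau>0] \<open>0 < a\<close> by (simp add: power2_eq_iff_nonneg)
  have max: "theta_max \<theta> = \<theta> \<tau>1"
    unfolding theta_max_def by (rule cSup_eq_maximum) (auto simp: mono upper)
  show energy: "b\<^sup>2 + (1 - b\<^sup>2) * \<nu> = a\<^sup>2"
    unfolding b_def max using x1 by (simp add: algebra_simps)
  have "sin (\<theta> \<tau>1) < sin (pi/2)"
    using theta_range[of \<tau>1] by (subst sin_mono_less_eq) auto
  then show b1: "b < 1" unfolding b_def max by simp
  have b0: "0 < b" unfolding b_def max by (rule pos)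
  then have "b\<^sup>2 < 1" using b1 by (simp add: abs_square_less_1)
  then have "(1 - b\<^sup>2) * \<nu> < 0" using nu_neg by (simp add: mult_pos_neg)
  then have "a\<^sup>2 < b\<^sup>2" using energy by simp
  then show "a < b" using b0 by (simp add: power2_less_imp_less)
qed

text \<open>
  Separation of variables. Injectivity of \<open>\<psi>\<close> is what makes the period unique.
\<close>

lemma twist_quadrature:
  assumes a: "0 < a" and pos: "\<And>\<tau>. 0 < sin (\<theta> \<tau>)"
    and integral: "\<And>\<tau>. (sin (\<theta> \<tau>))\<^sup>2 * (1 - \<nu> * (sin (\<psi> \<tau>))\<^sup>2) = a\<^sup>2 - \<nu> * (sin (\<psi> \<tau>))\<^sup>2"
  defines "P \<equiv> 4 / \<gamma> * integral {0..pi/2} (\<lambda>y. 1 / twist_rate a \<nu> ((sin y)\<^sup>2))"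
  shows "inj \<psi>" "0 < P"
    and "\<psi> (\<tau> + P) = \<psi> \<tau> + 2 * pi" "\<theta> (\<tau> + P) = \<theta> \<tau>"
    and "\<phi> (\<tau> + P) - \<phi> \<tau> - P
      = 4 * integral {0..pi/2} (\<lambda>y. \<nu> * (sin y)\<^sup>2 / twist_rate a \<nu> ((sin y)\<^sup>2))"
proof -
  define R where "R = (\<lambda>y. twist_rate a \<nu> ((sin y)\<^sup>2))"
  have R: "0 < R y" for y unfolding R_def using a nu_neg by (intro twist_rate_pos) auto
  have R_cont: "continuous_on A R" for A
    unfolding R_def twist_rate_def by (intro continuous_intros)
  have R_sym: "R (y + pi) = R y" "R (- y) = R y" for y
    by (simp_all add: R_def)
  have rate: "sin (\<theta> \<tau>) * (1 - \<nu> * (sin (\<psi> \<tau>))\<^sup>2) = R (\<psi> \<tau>)" for \<tau>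
    unfolding R_def twist_rate_def integral[symmetric]
    using pos[of \<tau>] one_minus_nu_S(1)[of "\<psi> \<tau>"]
    by (intro real_sqrt_unique[symmetric]) (auto simp: power2_eq_square algebra_simps)
  have speed: "(\<psi> has_real_derivative \<gamma> * R (\<psi> \<tau>)) (at \<tau>)" for \<tau>
    using psi_deriv[of \<tau>] rate[of \<tau>] by (simp add: mult.assoc)
  have "\<psi> s < \<psi> t" if "s < t" for s t
    using that speed gamma_pos R by (intro DERIV_pos_imp_increasing[of s t \<psi>]) (auto intro: mult_pos_pos)
  then show inj: "inj \<psi>" by (intro linorder_injI) (metis less_irrefl)
  have nz: "R y \<noteq> 0" for y using R[of y] by simp
  have F_cont: "continuous_on UNIV (\<lambda>y. 1 / R y)"
    by (intro continuous_intros R_cont) (simp add: nz)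
  obtain F where F: "\<And>y. (F has_real_derivative 1 / R y) (at y)"
    and F_turn: "\<And>y. F (y + 2 * pi) - F y = 4 * integral {0..pi/2} (\<lambda>y. 1 / R y)"
    by (rule antiderivative_full_turn[OF F_cont]) (simp add: R_sym, simp add: R_sym, blast)
  have H_cont: "continuous_on UNIV (\<lambda>y. \<nu> * (sin y)\<^sup>2 / R y)"
    by (intro continuous_intros R_cont) (simp add: nz)
  obtain H where H: "\<And>y. (H has_real_derivative \<nu> * (sin y)\<^sup>2 / R y) (at y)"
    and H_turn: "\<And>y. H (y + 2 * pi) - H y = 4 * integral {0..pi/2} (\<lambda>y. \<nu> * (sin y)\<^sup>2 / R y)"
    by (rule antiderivative_full_turn[OF H_cont]) (simp add: R_sym, simp add: R_sym, blast)
  have F_less: "F y < F z" if "y < z" for y z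
  proof (rule DERIV_pos_imp_increasing[OF that], intro exI conjI)
    show "(F has_real_derivative 1 / R x) (at x)" "0 < 1 / R x" for x
      using F R by simp_all
  qed
  have P: "\<gamma> * P = F (y + 2 * pi) - F y" for y
    unfolding F_turn P_def using gamma_pos by (simp add: R_def)
  have "0 < \<gamma> * P" unfolding P[of 0] using F_less[of 0 "0 + 2 * pi"] by simp
  then show "0 < P" using gamma_pos by (simp add: zero_less_mult_iff)
  \<comment> \<open>Up to scale and origin, \<open>F\<close> reads off the time from the twist angle.\<close>
  have "((\<lambda>\<tau>. F (\<psi> \<tau>) - \<gamma> * \<tau>) has_real_derivative 0) (at \<tau>)" for \<tau>
    using DERIV_diff[OF DERIV_chain2[OF F speed] DERIV_cmult_Id[of \<gamma>]] by (simp add: nz)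
  then have clock: "F (\<psi> s) - \<gamma> * s = F (\<psi> t) - \<gamma> * t" for s t
    by (intro DERIV_isconst_all[of "\<lambda>\<tau>. F (\<psi> \<tau>) - \<gamma> * \<tau>"] allI)
  have "F (\<psi> (\<tau> + P)) = F (\<psi> \<tau> + 2 * pi)" for \<tau>
    using clock[of "\<tau> + P" \<tau>] P[of "\<psi> \<tau>"] by (simp add: algebra_simps)
  then show turn: "\<psi> (\<tau> + P) = \<psi> \<tau> + 2 * pi" for \<tau>
    using F_less[of "\<psi> (\<tau> + P)" "\<psi> \<tau> + 2 * pi" for \<tau>]
      F_less[of "\<psi> \<tau> + 2 * pi" "\<psi> (\<tau> + P)" for \<tau>]
    by (metis less_irrefl linorder_neqE)
  have "(sin (\<theta> (\<tau> + P)))\<^sup>2 * (1 - \<nu> * (sin (\<psi> \<tau>))\<^sup>2) = (sin (\<theta> \<tau>))\<^sup>2 * (1 - \<nu> * (sin (\<psi> \<tau>))\<^sup>2)"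
    using integral[of "\<tau> + P"] integral[of \<tau>] by (simp add: turn)
  then have "(sin (\<theta> (\<tau> + P)))\<^sup>2 = (sin (\<theta> \<tau>))\<^sup>2"
    using one_minus_nu_S(1)[of "\<psi> \<tau>"] by simp
  then have "sin (\<theta> (\<tau> + P)) = sin (\<theta> \<tau>)"
    by (rule power2_eq_imp_eq) (intro less_imp_le pos)+
  then show "\<theta> (\<tau> + P) = \<theta> \<tau>"
    by (rule sin_inj_pi[rotated 4])
       (rule less_imp_le[OF theta_range(1)] less_imp_le[OF theta_range(2)])+
  have "((\<lambda>\<tau>. \<phi> \<tau> - \<tau> - H (\<psi> \<tau>)) has_real_derivative 0) (at \<tau>)" for \<tau>
    using DERIV_diff[OF DERIV_diff[OF phi_deriv DERIV_ident] DERIV_chain2[OF H speed]]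
    by (simp add: nz)
  then have "\<phi> (\<tau> + P) - (\<tau> + P) - H (\<psi> (\<tau> + P)) = \<phi> \<tau> - \<tau> - H (\<psi> \<tau>)"
    by (intro DERIV_isconst_all[of "\<lambda>\<tau>. \<phi> \<tau> - \<tau> - H (\<psi> \<tau>)"] allI)
  then show "\<phi> (\<tau> + P) - \<phi> \<tau> - P
      = 4 * integral {0..pi/2} (\<lambda>y. \<nu> * (sin y)\<^sup>2 / twist_rate a \<nu> ((sin y)\<^sup>2))"
    using H_turn[of "\<psi> \<tau>", unfolded R_def] unfolding turn by linarith
qed

end

section \<open>Period and somersault\<close>

theorem lemma9:
  fixes I1 I2 I3 l \<delta> \<gamma> \<nu> s_minus s_plus k n_minus n_plus :: real
    and \<phi> \<theta> \<psi> :: "real \<Rightarrow> real"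
  assumes "0 < I3" and "I3 < I1" and "I1 < I2" and "0 < l"
    and "\<delta> = I1 / I2 - 1" and "\<gamma> = I1 / I3 - 1" and "\<nu> = \<delta> / \<gamma>"
    and "rotor_off_motion \<delta> \<gamma> \<phi> \<theta> \<psi>" and "twisting \<psi>"
    and "s_minus = sin (theta_min \<theta>)" and "s_plus = sin (theta_max \<theta>)"
    and "k = (s_plus - s_minus) / (s_plus + s_minus)"
    and "n_plus = k * ((1 + s_minus) / (1 - s_minus))"
    and "n_minus = k * ((1 - s_minus) / (1 + s_minus))"
  shows "(\<exists>!P3. twist_period I1 l \<theta> \<psi> P3) \<and>
    (\<forall>P3 P3_hat. twist_period I1 l \<theta> \<psi> P3 \<and> P3_hat = l * P3 / I1 \<longrightarrow>
       \<gamma> * P3_hat = 8 / ((s_plus + s_minus) * sqrt (1 - \<nu>)) * ellipticK (k\<^sup>2) \<and>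
       (\<forall>\<tau> \<Phi>3. \<Phi>3 = \<phi> (\<tau> + P3_hat) - \<phi> \<tau> \<longrightarrow>
          \<Phi>3 - P3_hat =
            8 * s_minus / ((s_plus + s_minus) * sqrt (1 - \<nu>)) *
              (ellipticPi n_minus (k\<^sup>2) - ellipticPi n_plus (k\<^sup>2))))"
proof -
  have "\<delta> < 0" "0 < \<gamma>" using assms(1-6) by simp_all
  then interpret T: twisting_motion \<delta> \<gamma> \<nu> \<phi> \<theta> \<psi>
    using assms by unfold_locales
  obtain a where "0 < a" and pos: "\<And>\<tau>. 0 < sin (\<theta> \<tau>)"
    and integral: "\<And>\<tau>. (sin (\<theta> \<tau>))\<^sup>2 * (1 - \<nu> * (sin (\<psi> \<tau>))\<^sup>2) = a\<^sup>2 - \<nu> * (sin (\<psi> \<tau>))\<^sup>2"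
    using T.twist_integral by blast
  note extrema = T.theta_extrema[OF \<open>0 < a\<close> pos integral]
  have a_eq: "s_minus = a" using extrema(1) assms(10) by simp
  interpret L: landen_parameters s_minus s_plus \<nu> k n_plus n_minus
    using extrema \<open>0 < a\<close> assms(10-14) by unfold_locales simp_all
  define P where "P = 4 / \<gamma> * integral {0..pi/2} (\<lambda>y. 1 / twist_rate s_minus \<nu> ((sin y)\<^sup>2))"
  note turn = T.twist_quadrature[OF \<open>0 < a\<close> pos integral, folded a_eq, folded P_def]
  have "0 < I1" using assms(1,2) by simp
  have "twist_period I1 l \<theta> \<psi> (I1 * P / l)"
  proof -
    have "(t + I1 * P / l) * l / I1 = t * l / I1 + P" for t
      using \<open>0 < I1\<close> \<open>0 < l\<close> by (simp add: field_simps)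
    then show ?thesis
      unfolding twist_period_def using turn(2-4) \<open>0 < I1\<close> \<open>0 < l\<close> by simp
  qed
  moreover have period: "l * P3 / I1 = P" if "twist_period I1 l \<theta> \<psi> P3" for P3
  proof -
    have "\<psi> ((0 + P3) * l / I1) = \<psi> (0 * l / I1) + 2 * pi"
      using that unfolding twist_period_def by blast
    then have "\<psi> (l * P3 / I1) = \<psi> P"
      using turn(3)[of 0] by (simp add: mult.commute)
    then show ?thesis using turn(1) by (simp add: inj_eq)
  qed
  moreover have "P3 = I1 * P / l" if "twist_period I1 l \<theta> \<psi> P3" for P3
    using period[OF that] \<open>0 < I1\<close> \<open>0 < l\<close> by (simp add: field_simps)
  moreover have "\<gamma> * P = 8 / ((s_plus + s_minus) * sqrt (1 - \<nu>)) * ellipticK (k\<^sup>2)"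
    unfolding P_def L.integral_eq_ellipticK using \<open>0 < \<gamma>\<close> by (simp add: add.commute)
  moreover have "\<phi> (\<tau> + P) - \<phi> \<tau> - P = 8 * s_minus / ((s_plus + s_minus) * sqrt (1 - \<nu>)) *
      (ellipticPi n_minus (k\<^sup>2) - ellipticPi n_plus (k\<^sup>2))" for \<tau>
    unfolding turn(5) L.integral_eq_ellipticPi_diff by (simp add: add.commute)
  ultimately show ?thesis by blast
qed

end
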